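(* Let $(f_\alpha)_{\alpha>0}$ be a regularizing filter, let $(u_\lambda,v_\lambda,\kappa_\lambda)_{\lambda\in\Lambda}$ be a diagonal frame decomposition (DFD) of $\mathbf K\colon\operatorname{dom}(\mathbf K)\subseteq\mathbb X\to\mathbb Y$, let $(\bar u_\lambda)_{\lambda\in\Lambda}$ be a dual frame of $(u_\lambda)_{\lambda\in\Lambda}$, and let $(\mathbf F_\alpha)_{\alpha>0}$ be the associated filtered DFD, $\mathbf F_\alpha y=\sum_{\lambda\in\Lambda}f_\alpha(\kappa_\lambda)\langle y,v_\lambda\rangle\bar u_\lambda$ for $y \in \mathbb Y$. Let $y\in\operatorname{dom}(\mathbf K^{+})$. Then $((\mathbf F_\alpha)_{\alpha>0},\alpha^* )$ is a regularization method for $\mathbf Kx=y$ provided that the parameter choice $\alpha^*\colon(0,\infty)\to(0,\infty)$ satisfies $$0=\lim_{\delta\to0}\alpha^*(\delta)=\lim_{\delta\to0}\delta\,\|f_{\alpha^*(\delta)}\|_\infty .$$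
   Context: $\mathbb X,\mathbb Y$ are Hilbert spaces over $\mathbb R$ or $\mathbb C$, and $\mathbf K\colon\operatorname{dom}(\mathbf K)\subseteq\mathbb X\to\mathbb Y$ is a closed, densely defined (possibly unbounded) linear operator. $\Lambda$ is an at most countable index set. Frames: a family $(u_\lambda)_{\lambda\in\Lambda}$ in a Hilbert space $\mathbb U$ is a frame for $\mathbb U$ if there are $A,B>0$ with $A\|x\|^2\le\sum_{\lambda}|\langle u_\lambda,x\rangle|^2\le B\|x\|^2$ for all $x\in\mathbb U$. A frame $(\bar u_\lambda)_\lambda$ for $\mathbb U$ is a dual frame of $(u_\lambda)_\lambda$ if $x=\sum_\lambda\langle x,u_\lambda\rangle\bar u_\lambda$ for all $x\in\mathbb U$. DFD: $(u_\lambda,v_\lambda,\kappa_\lambda)_{\lambda\in\Lambda}$ is a DFD for $\mathbf K$ if $(u_\lambda)_\lambda$ is a frame for $(\ker\mathbf K)^\perp$, $(v_\lambda)_\lambda$ is a frame for $\overline{\operatorname{ran}\mathbf K}$, $\kappa_\lambda\in(0,\infty)$ for all $\lambda$, and $v_\lambda\in\operatorname{dom}(\mathbf K^* )$ with $\mathbf K^*v_\lambda=\kappa_\lambda u_\lambda$ for all $\lambda$. The dual frame $(\bar u_\lambda)_\lambda$ is a dual frame in $(\ker\mathbf K)^\perp$. Regularizing filter: a family $(f_\alpha)_{\alpha>0}$ of piecewise continuous functions $f_\alpha\colon(0,\infty)\to\mathbb R$ such that (i) $\|f_\alpha\|_\infty=\sup_{\kappa>0}|f_\alpha(\kappa)|<\infty$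 for every $\alpha>0$; (ii) there is $C>0$ with $|\kappa f_\alpha(\kappa)|\le C$ for all $\alpha>0$, $\kappa>0$; (iii) $\lim_{\alpha\to0}f_\alpha(\kappa)=1/\kappa$ for every $\kappa\in(0,\infty)$. Moore–Penrose inverse: $\operatorname{dom}(\mathbf K^{+})=\operatorname{ran}(\mathbf K)\oplus\operatorname{ran}(\mathbf K)^\perp$, and $\mathbf K^{+}y$ is the unique $x\in\operatorname{dom}(\mathbf K)\cap(\ker\mathbf K)^\perp$ with $\mathbf Kx=\mathbf P_{\overline{\operatorname{ran}\mathbf K}}\,y$ ($\mathbf P$ denotes orthogonal projection). Regularization method: for a family $(\mathbf R_\alpha)_{\alpha>0}$ of continuous operators $\mathbf R_\alpha\colon\mathbb Y\to\mathbb X$, $y\in\operatorname{dom}(\mathbf K^{+})$ and $\alpha^*\colon(0,\infty)\times\mathbb Y\to(0,\infty)$, the pair $((\mathbf R_\alpha)_{\alpha>0},\alpha^* )$ is a regularization method for the solution of $\mathbf Kx=y$ if $$\lim_{\delta\to0}\sup\{\alpha^*(\delta,y^\delta)\mid y^\delta\in\mathbb Y,\ \|y^\delta-y\|\le\delta\}=0$$ and $$\lim_{\delta\to0}\sup\{\|\mathbf K^{+}y-\mathbf R_{\alpha^*(\delta,y^\delta)}y^\delta\|\mid y^\delta\in\mathbb Y,\ \|y^\delta-y\|\le\delta\}=0.$$ A function $\alpha^*$ of $\delta$ only is regarded as a parameter choice not depending on $y^\delta$. *)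

theory Defs
  imports "HOL-Analysis.Analysis"
begin

text \<open>
  The distribution has no complex inner product spaces. The scalars are therefore taken from a type
  class with instances \<^typ>\<open>real\<close> and \<^typ>\<open>complex\<close>;
  lemma \<open>real_or_complex\<close> below
  shows that these are the only possibilities.
\<close>

class scalar_field = real_normed_field +
  fixes kcnj :: "'a \<Rightarrow> 'a"
  assumes kcnj_add: "kcnj (a + b) = kcnj a + kcnj b"
    and kcnj_mult: "kcnj (a * b) = kcnj a * kcnj b"
    and kcnj_kcnj: "kcnj (kcnj a) = a"
    and mult_kcnj_scaleR: "a * kcnj a = (norm a)\<^sup>2 *\<^sub>R 1"
    and add_kcnj_scaleR: "\<exists>r. a + kcnj a = r *\<^sub>R 1"

instantiation real :: scalar_field
begin
definition kcnj_real :: "real \<Rightarrow> real" where "kcnj_real a = a"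
instance
  by standard (auto simp: kcnj_real_def power2_eq_square)
end

instantiation complex :: scalar_field
begin
definition kcnj_complex :: "complex \<Rightarrow> complex" where "kcnj_complex a = cnj a"
instance
proof
  fix a :: complex
  show "a * kcnj a = (norm a)\<^sup>2 *\<^sub>R 1"
    by (simp add: kcnj_complex_def scaleR_conv_of_real flip: complex_norm_square)
  show "\<exists>r. a + kcnj a = r *\<^sub>R 1"
    by (rule exI[of _ "2 * Re a"]) (simp add: kcnj_complex_def scaleR_conv_of_real complex_add_cnj)
qed (auto simp: kcnj_complex_def)
end

lemma mult_kcnj: "a * kcnj a = of_real ((norm a)\<^sup>2)" for a :: "'k::scalar_field"
  by (simp add: mult_kcnj_scaleR of_real_def)

lemma real_or_complex:
  "(\<forall>z::'k::scalar_field. \<exists>a. z = of_real a) \<or>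
   (\<exists>i::'k. i * i = -1 \<and> (\<forall>z. \<exists>a b. z = of_real a + of_real b * i))"
proof -
  have add_kcnj: "\<exists>p. z + kcnj z = of_real p" for z :: 'k
    using add_kcnj_scaleR[of z] by (simp add: of_real_def)
  show ?thesis
  proof (cases "\<forall>z::'k. \<exists>a. z = of_real a")
    case False
    then obtain w :: 'k where w: "\<And>a. w \<noteq> of_real a" by blast
    obtain p where p: "w + kcnj w = of_real p" using add_kcnj[of w] by blast
    have kcnj_of_real: "kcnj (of_real r :: 'k) = of_real r" for r
    proof (cases "r = 0")
      case True
      have "kcnj (0::'k) + kcnj 0 = kcnj 0" using kcnj_add[of "0::'k" 0] by simp
      with True show ?thesis by simp
    next
      case False
      have "of_real r * kcnj (of_real r :: 'k) = of_real r * of_real r"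
        using mult_kcnj[of "of_real r :: 'k"] by (simp add: power2_eq_square flip: of_real_mult)
      with False show ?thesis by simp
    qed
    define t where "t = w - of_real (p / 2)"
    have ct: "kcnj t = - t"
    proof -
      have "t = w + of_real (- p / 2)" by (simp add: t_def)
      then have "kcnj t = kcnj w + of_real (- p / 2)"
        by (simp only: kcnj_add kcnj_of_real)
      also have "\<dots> = of_real p - w + of_real (- p / 2)"
        using p by (simp add: algebra_simps)
      also have "\<dots> = - t"
      proof -
        have "of_real p = (of_real (p/2) + of_real (p/2) :: 'k)"
          by (simp only: of_real_add[symmetric] field_sum_of_halves)
        then show ?thesis by (simp add: t_def algebra_simps)
      qed
      finally show ?thesis .
    qed
    have t0: "t \<noteq> 0" using w[of "p / 2"] by (auto simp: t_def)
    define i where "i = t / of_real (norm t)"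
    have tt: "t * t = - of_real ((norm t)\<^sup>2)"
      using mult_kcnj[of t] unfolding ct mult_minus_right
      by (rule minus_equation_iff[THEN iffD1, symmetric])
    have ii: "i * i = -1"
    proof -
      have "i * i = (t * t) / of_real ((norm t)\<^sup>2)"
        by (simp add: i_def power2_eq_square)
      then show ?thesis unfolding tt using t0 by simp
    qed
    have ci: "kcnj i = - i"
    proof -
      have t: "i * of_real (norm t) = t" using t0 by (simp add: i_def)
      have "kcnj i * of_real (norm t) = kcnj (i * of_real (norm t))"
        by (simp only: kcnj_mult kcnj_of_real)
      also have "\<dots> = - i * of_real (norm t)"
        unfolding t ct by (simp add: t)
      finally show ?thesis
        by (rule mult_right_cancel[THEN iffD1, rotated]) (simp add: t0)
    qed
    have "\<exists>a b. z = of_real a + of_real b * i" for z :: 'k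
    proof -
      obtain a where a: "z + kcnj z = of_real a" using add_kcnj[of z] by blast
      obtain b where b: "z * i + kcnj (z * i) = of_real b" using add_kcnj[of "z * i"] by blast
      have "(z - kcnj z) * i = of_real b"
        using b ci by (simp add: kcnj_mult left_diff_distrib)
      then have "(z - kcnj z) * (i * i) = of_real b * i"
        by (simp flip: mult.assoc)
      then have "- (z - kcnj z) = of_real b * i"
        unfolding ii mult_minus1_right .
      then have d: "z - kcnj z = - (of_real b * i)"
        by (rule minus_equation_iff[THEN iffD1, symmetric])
      have "z + z = (z + kcnj z) + (z - kcnj z)" by simp
      then have "2 * z = of_real a - of_real b * i"
        unfolding a d mult_2 by (simp only: add_uminus_conv_diff)
      then have "z = (of_real a - of_real b * i) / 2"
        by (simp flip: \<open>2 * z = _\<close>)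
      then have "z = of_real (a / 2) + of_real (- b / 2) * i"
        by (simp add: diff_divide_distrib)
      then show ?thesis by blast
    qed
    with ii show ?thesis by blast
  qed blast
qed

text \<open>Inner products are linear in the first argument; completeness comes from the class
  \<^class>\<open>banach\<close>.\<close>

locale hilbert_space = vector_space scale
  for scale :: "'k::scalar_field \<Rightarrow> 'a::banach \<Rightarrow> 'a" +
  fixes ip :: "'a \<Rightarrow> 'a \<Rightarrow> 'k"
  assumes scale_of_real: "scale (of_real r) x = r *\<^sub>R x"
    and ip_add_left: "ip (x + y) z = ip x z + ip y z"
    and ip_scale_left: "ip (scale c x) y = c * ip x y"
    and ip_conj: "ip y x = kcnj (ip x y)"
    and ip_self: "ip x x = of_real ((norm x)\<^sup>2)"

definition orth_compl :: "('a \<Rightarrow> 'a \<Rightarrow> 'k::scalar_field) \<Rightarrow> 'a set \<Rightarrow> 'a set" where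
  "orth_compl ip S = {x. \<forall>z\<in>S. ip x z = 0}"

definition orth_proj ::
  "('a::banach \<Rightarrow> 'a \<Rightarrow> 'k::scalar_field) \<Rightarrow> 'a set \<Rightarrow> 'a \<Rightarrow> 'a" where
  "orth_proj ip S y = (THE p. p \<in> S \<and> y - p \<in> orth_compl ip S)"

text \<open>An unbounded operator is given by its domain \<open>D\<close> and a function \<open>K\<close>, whose values
  outside \<open>D\<close> are irrelevant.\<close>

definition closed_dense_operator ::
  "('k::scalar_field \<Rightarrow> 'x::banach \<Rightarrow> 'x) \<Rightarrow> ('k \<Rightarrow> 'y::banach \<Rightarrow> 'y) \<Rightarrow> 'x set \<Rightarrow> ('x \<Rightarrow> 'y) \<Rightarrow> bool"
  where
  "closed_dense_operator scaleX scaleY D K \<longleftrightarrow>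
     module.subspace scaleX D \<and>
     (\<forall>x\<in>D. \<forall>x'\<in>D. K (x + x') = K x + K x') \<and>
     (\<forall>c. \<forall>x\<in>D. K (scaleX c x) = scaleY c (K x)) \<and>
     closure D = UNIV \<and>
     closed ((\<lambda>x. (x, K x)) ` D)"

definition op_ker :: "'x set \<Rightarrow> ('x \<Rightarrow> 'y::zero) \<Rightarrow> 'x set" where
  "op_ker D K = {x \<in> D. K x = 0}"

definition op_ran :: "'x set \<Rightarrow> ('x \<Rightarrow> 'y) \<Rightarrow> 'y set" where
  "op_ran D K = K ` D"

definition adj_dom ::
  "('x \<Rightarrow> 'x \<Rightarrow> 'k) \<Rightarrow> ('y \<Rightarrow> 'y \<Rightarrow> 'k) \<Rightarrow> 'x set \<Rightarrow> ('x \<Rightarrow> 'y) \<Rightarrow> 'y set" where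
  "adj_dom ipX ipY D K = {v. \<exists>w. \<forall>x\<in>D. ipY (K x) v = ipX x w}"

definition adj ::
  "('x \<Rightarrow> 'x \<Rightarrow> 'k) \<Rightarrow> ('y \<Rightarrow> 'y \<Rightarrow> 'k) \<Rightarrow> 'x set \<Rightarrow> ('x \<Rightarrow> 'y) \<Rightarrow> 'y \<Rightarrow> 'x" where
  "adj ipX ipY D K v = (THE w. \<forall>x\<in>D. ipY (K x) v = ipX x w)"

text \<open>Frames for a closed subspace \<open>U\<close>, itself regarded as a Hilbert space. Summability is
  required explicitly because \<open>infsum\<close> is \<open>0\<close> on families that are not summable.\<close>

definition frame ::
  "('a \<Rightarrow> 'a \<Rightarrow> 'k::scalar_field) \<Rightarrow> 'a set \<Rightarrow> 'i set \<Rightarrow> ('i \<Rightarrow> 'a::banach) \<Rightarrow> bool" where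
  "frame ip U I u \<longleftrightarrow>
     (\<forall>i\<in>I. u i \<in> U) \<and>
     (\<exists>A>0. \<exists>B>0. \<forall>x\<in>U.
        (\<lambda>i. (norm (ip (u i) x))\<^sup>2) summable_on I \<and>
        A * (norm x)\<^sup>2 \<le> (\<Sum>\<^sub>\<infinity>i\<in>I. (norm (ip (u i) x))\<^sup>2) \<and>
        (\<Sum>\<^sub>\<infinity>i\<in>I. (norm (ip (u i) x))\<^sup>2) \<le> B * (norm x)\<^sup>2)"

text \<open>\<open>has_sum\<close> expresses unconditional convergence. This is no restriction: the coefficients are
  square summable, and square summable combinations of a frame converge unconditionally.\<close>

definition dual_frame ::
  "('k \<Rightarrow> 'a \<Rightarrow> 'a) \<Rightarrow> ('a \<Rightarrow> 'a \<Rightarrow> 'k::scalar_field) \<Rightarrow> 'a set \<Rightarrow> 'i set \<Rightarrow>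
   ('i \<Rightarrow> 'a::banach) \<Rightarrow> ('i \<Rightarrow> 'a) \<Rightarrow> bool" where
  "dual_frame scl ip U I u u' \<longleftrightarrow>
     frame ip U I u' \<and>
     (\<forall>x\<in>U. ((\<lambda>i. scl (ip x (u i)) (u' i)) has_sum x) I)"

definition dfd ::
  "('k::scalar_field \<Rightarrow> 'x \<Rightarrow> 'x) \<Rightarrow> ('x::banach \<Rightarrow> 'x \<Rightarrow> 'k) \<Rightarrow> ('y::banach \<Rightarrow> 'y \<Rightarrow> 'k) \<Rightarrow>
   'x set \<Rightarrow> ('x \<Rightarrow> 'y) \<Rightarrow> 'i set \<Rightarrow> ('i \<Rightarrow> 'x) \<Rightarrow> ('i \<Rightarrow> 'y) \<Rightarrow> ('i \<Rightarrow> real) \<Rightarrow> bool" where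
  "dfd scaleX ipX ipY D K I u v \<kappa> \<longleftrightarrow>
     frame ipX (orth_compl ipX (op_ker D K)) I u \<and>
     frame ipY (closure (op_ran D K)) I v \<and>
     (\<forall>i\<in>I. 0 < \<kappa> i) \<and>
     (\<forall>i\<in>I. v i \<in> adj_dom ipX ipY D K \<and>
            adj ipX ipY D K (v i) = scaleX (of_real (\<kappa> i)) (u i))"

text \<open>Piecewise continuity on the open half-line: finitely many discontinuities in every compact
  subinterval, and finite one-sided limits everywhere.\<close>

definition piecewise_continuous :: "(real \<Rightarrow> real) \<Rightarrow> bool" where
  "piecewise_continuous g \<longleftrightarrow>
     (\<forall>a>0. \<forall>b. finite {x \<in> {a..b}. \<not> isCont g x}) \<and>
     (\<forall>x>0. (\<exists>l. (g \<longlongrightarrow> l) (at_left x)) \<and> (\<exists>l. (g \<longlongrightarrow> l) (at_right x)))"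

definition filter_norm :: "(real \<Rightarrow> real) \<Rightarrow> real" where
  "filter_norm g = (SUP \<kappa>\<in>{0<..}. \<bar>g \<kappa>\<bar>)"

definition regularizing_filter :: "(real \<Rightarrow> real \<Rightarrow> real) \<Rightarrow> bool" where
  "regularizing_filter f \<longleftrightarrow>
     (\<forall>\<alpha>>0. piecewise_continuous (f \<alpha>)) \<and>
     (\<forall>\<alpha>>0. bdd_above ((\<lambda>\<kappa>. \<bar>f \<alpha> \<kappa>\<bar>) ` {0<..})) \<and>
     (\<exists>C>0. \<forall>\<alpha>>0. \<forall>\<kappa>>0. \<bar>\<kappa> * f \<alpha> \<kappa>\<bar> \<le> C) \<and>
     (\<forall>\<kappa>>0. ((\<lambda>\<alpha>. f \<alpha> \<kappa>) \<longlongrightarrow> 1 / \<kappa>) (at_right 0))"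

text \<open>For a DFD with a dual frame and a regularizing filter this series is summable for all \<open>\<alpha> > 0\<close>
  and all \<open>y\<close> (bounded multiples of frame coefficients are square summable), so the value \<open>0\<close> that
  \<open>infsum\<close> gives to other families plays no role.\<close>

definition filtered_dfd ::
  "('k::scalar_field \<Rightarrow> 'x::banach \<Rightarrow> 'x) \<Rightarrow> ('y::banach \<Rightarrow> 'y \<Rightarrow> 'k) \<Rightarrow> (real \<Rightarrow> real \<Rightarrow> real) \<Rightarrow>
   'i set \<Rightarrow> ('i \<Rightarrow> 'x) \<Rightarrow> ('i \<Rightarrow> 'y) \<Rightarrow> ('i \<Rightarrow> real) \<Rightarrow> real \<Rightarrow> 'y \<Rightarrow> 'x" where
  "filtered_dfd scaleX ipY f I u' v \<kappa> \<alpha> y =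
     (\<Sum>\<^sub>\<infinity>i\<in>I. scaleX (of_real (f \<alpha> (\<kappa> i)) * ipY y (v i)) (u' i))"

definition mp_dom ::
  "('y::banach \<Rightarrow> 'y \<Rightarrow> 'k::scalar_field) \<Rightarrow> 'x set \<Rightarrow> ('x \<Rightarrow> 'y) \<Rightarrow> 'y set" where
  "mp_dom ipY D K = {a + b | a b. a \<in> op_ran D K \<and> b \<in> orth_compl ipY (op_ran D K)}"

definition mp_inv ::
  "('x::banach \<Rightarrow> 'x \<Rightarrow> 'k::scalar_field) \<Rightarrow> ('y::banach \<Rightarrow> 'y \<Rightarrow> 'k) \<Rightarrow> 'x set \<Rightarrow> ('x \<Rightarrow> 'y) \<Rightarrow> 'y \<Rightarrow> 'x"
  where
  "mp_inv ipX ipY D K y =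
     (THE x. x \<in> D \<inter> orth_compl ipX (op_ker D K) \<and>
             K x = orth_proj ipY (closure (op_ran D K)) y)"

text \<open>The suprema are taken in \<^typ>\<open>ereal\<close>, since they may be infinite for large \<open>\<delta>\<close>.\<close>

definition regularization_method ::
  "('x::banach \<Rightarrow> 'x \<Rightarrow> 'k::scalar_field) \<Rightarrow> ('y::banach \<Rightarrow> 'y \<Rightarrow> 'k) \<Rightarrow> 'x set \<Rightarrow> ('x \<Rightarrow> 'y) \<Rightarrow>
   'y \<Rightarrow> (real \<Rightarrow> 'y \<Rightarrow> 'x) \<Rightarrow> (real \<Rightarrow> 'y \<Rightarrow> real) \<Rightarrow> bool" where
  "regularization_method ipX ipY D K y R a \<longleftrightarrow>
     y \<in> mp_dom ipY D K \<and>
     (\<forall>\<alpha>>0. continuous_on UNIV (R \<alpha>)) \<and>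
     (\<forall>\<delta>>0. \<forall>z. 0 < a \<delta> z) \<and>
     ((\<lambda>\<delta>. SUP z\<in>{z. norm (z - y) \<le> \<delta>}. ereal (a \<delta> z)) \<longlongrightarrow> 0) (at_right 0) \<and>
     ((\<lambda>\<delta>. SUP z\<in>{z. norm (z - y) \<le> \<delta>}.
          ereal (norm (mp_inv ipX ipY D K y - R (a \<delta> z) z))) \<longlongrightarrow> 0) (at_right 0)"

end

theory Submission imports Defs begin

text \<open>
  Write \<open>x = K\<^sup>+ y\<close>, and \<open>R\<^sub>\<alpha>\<close> for the filtered decomposition. Since
  \<open>K* v\<^sub>i = \<kappa>\<^sub>i u\<^sub>i\<close> and \<open>y - K x\<close> is orthogonal to the closure of the range, which contains \<open>v\<^sub>i\<close>,
  the data coefficients are \<open>\<langle>y, v\<^sub>i\<rangle> = \<kappa>\<^sub>i \<langle>x, u\<^sub>i\<rangle>\<close>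
  (\<open>dfd_coefficient\<close>). As \<open>x\<close> lies in the orthogonal complement of the kernel, the dual frame
  reproduces it, and for exact data
  \<open>x - R\<^sub>\<alpha> y = \<Sum>\<^sub>i (1 - \<kappa>\<^sub>i f\<^sub>\<alpha>(\<kappa>\<^sub>i)) \<langle>x, u\<^sub>i\<rangle> u'\<^sub>i\<close>.
  A frame satisfies a Bessel inequality, equivalently its synthesis map is bounded on square summable
  coefficients (\<open>bessel_synthesis\<close>), so the squared error is at most a constant times
  \<open>\<Sum>\<^sub>i (1 - \<kappa>\<^sub>i f\<^sub>\<alpha>(\<kappa>\<^sub>i))\<^sup>2 |\<langle>x, u\<^sub>i\<rangle>|\<^sup>2\<close>. Every factor \<open>(1 - \<kappa>\<^sub>i f\<^sub>\<alpha>(\<kappa>\<^sub>i))\<^sup>2\<close> tends to \<open>0\<close> and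
  is bounded by \<open>(1 + C)\<^sup>2\<close>, so the sum tends to \<open>0\<close> by dominated convergence
  (\<open>filtered_dfd_exact_data_tendsto\<close>).

  For noisy data \<open>z\<close> with \<open>\<parallel>z - y\<parallel> \<le> \<delta>\<close>, the Bessel inequalities for \<open>v\<close> and \<open>u'\<close> bound the operator
  norm of \<open>R\<^sub>\<alpha>\<close> by a constant times \<open>\<parallel>f\<^sub>\<alpha>\<parallel>\<close> (\<open>filtered_dfd_bounded\<close>). This gives continuity of \<open>R\<^sub>\<alpha>\<close>
  and, by linearity, a propagated noise of at most a constant times \<open>\<delta> \<parallel>f\<^sub>\<alpha>\<parallel>\<close>, uniformly in \<open>z\<close>. With
  \<open>\<alpha> = a \<delta>\<close> both contributions vanish as \<open>\<delta>\<close> tends to \<open>0\<close>.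
\<close>

section \<open>Geometry of Hilbert spaces over the scalar field\<close>

lemma kcnj_0 [simp]: "kcnj (0::'k::scalar_field) = 0"
  using kcnj_add[of "0::'k" 0] by simp

lemma norm_kcnj [simp]: "norm (kcnj z) = norm (z::'k::scalar_field)"
proof (cases "z = 0")
  case False
  have "norm z * norm (kcnj z) = (norm z)\<^sup>2"
    by (simp add: mult_kcnj norm_power flip: norm_mult)
  with False show ?thesis by (simp add: power2_eq_square)
qed simp

lemma kcnj_of_real [simp]: "kcnj (of_real r) = (of_real r :: 'k::scalar_field)"
proof (cases "r = 0")
  case False
  have "of_real r * kcnj (of_real r :: 'k) = of_real r * of_real r"
    using mult_kcnj[of "of_real r :: 'k"] by (simp add: power2_eq_square flip: of_real_mult)
  with False show ?thesis by simp
qed simp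

lemma kcnj_minus [simp]: "kcnj (- z) = - kcnj (z::'k::scalar_field)"
  using kcnj_add[of z "- z"] by (simp add: eq_neg_iff_add_eq_0 add.commute)

context hilbert_space
begin

lemma ip_add_right: "ip x (y + z) = ip x y + ip x z"
  by (metis ip_conj ip_add_left kcnj_add)

lemma ip_scale_right: "ip x (scale c y) = kcnj c * ip x y"
  by (metis ip_conj ip_scale_left kcnj_mult)

lemma ip_minus_left: "ip (- x) y = - ip x y"
  using ip_scale_left[of "- 1" x y] scale_of_real[of "- 1" x] by simp

lemma ip_minus_right: "ip x (- y) = - ip x y"
  by (metis ip_conj ip_minus_left kcnj_minus)

lemma ip_diff_left: "ip (x - y) z = ip x z - ip y z"
  using ip_add_left[of x "- y" z] by (simp add: ip_minus_left)

lemma ip_diff_right: "ip x (y - z) = ip x y - ip x z"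
  using ip_add_right[of x y "- z"] by (simp add: ip_minus_right)

lemma ip_0_left [simp]: "ip 0 x = 0"
  using ip_add_left[of 0 0 x] by simp

lemma ip_0_right [simp]: "ip x 0 = 0"
  using ip_add_right[of x 0 0] by simp

lemma ip_sum_left: "ip (sum g F) y = (\<Sum>i\<in>F. ip (g i) y)"
  by (induction F rule: infinite_finite_induct) (auto simp: ip_add_left)

lemma ip_sum_right: "ip x (sum g F) = (\<Sum>i\<in>F. ip x (g i))"
  by (induction F rule: infinite_finite_induct) (auto simp: ip_add_right)

lemma norm_ip_commute: "norm (ip x y) = norm (ip y x)"
  by (metis ip_conj norm_kcnj)

lemma ip_eq_0_commute: "ip x y = 0 \<longleftrightarrow> ip y x = 0"
  using norm_ip_commute[of x y] by (metis norm_eq_zero)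

lemma norm_scale: "norm (scale c x) = norm c * norm x"
proof -
  have "(of_real ((norm (scale c x))\<^sup>2) :: 'k) = of_real ((norm c * norm x)\<^sup>2)"
    using mult_kcnj[of c]
    by (simp only: ip_self[symmetric] ip_scale_left ip_scale_right)
      (simp add: ip_self power_mult_distrib mult.left_commute flip: mult.assoc)
  then have "(norm (scale c x))\<^sup>2 = (norm c * norm x)\<^sup>2"
    by (simp only: of_real_eq_iff)
  then show ?thesis by (simp add: power2_eq_iff_nonneg)
qed

text \<open>The norm identity for subtracting the component along \<open>s\<close>. It gives the Cauchy--Schwarz
  inequality, and also orthogonality of the residual of a best approximation.\<close>

lemma norm_subtract_component:
  assumes "s \<noteq> 0"
  shows "(norm (x - scale (ip x s / of_real ((norm s)\<^sup>2)) s))\<^sup>2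
           = (norm x)\<^sup>2 - (norm (ip x s))\<^sup>2 / (norm s)\<^sup>2"
proof -
  define c where "c = ip x s / of_real ((norm s)\<^sup>2)"
  have n: "(of_real ((norm s)\<^sup>2) :: 'k) \<noteq> 0" using assms by simp
  have cs: "c * of_real ((norm s)\<^sup>2) = ip x s"
    unfolding c_def by (rule nonzero_eq_divide_eq[OF n, THEN iffD1]) (rule refl)
  have "ip (x - scale c s) (x - scale c s) = ip (x - scale c s) x - kcnj c * ip (x - scale c s) s"
    by (simp add: ip_diff_right ip_scale_right)
  also have "ip (x - scale c s) s = 0"
    by (simp only: ip_diff_left ip_scale_left ip_self cs diff_self)
  also have "ip (x - scale c s) x = ip x x - c * ip s x"
    by (simp add: ip_diff_left ip_scale_left)
  also have "c * ip s x = of_real ((norm (ip x s))\<^sup>2 / (norm s)\<^sup>2)"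
    using mult_kcnj[of "ip x s"] by (simp add: c_def ip_conj[of s x])
  finally have "(of_real ((norm (x - scale c s))\<^sup>2) :: 'k)
      = of_real ((norm x)\<^sup>2 - (norm (ip x s))\<^sup>2 / (norm s)\<^sup>2)"
    by (simp only: ip_self mult_zero_right diff_zero of_real_diff)
  then show ?thesis by (simp only: of_real_eq_iff c_def)
qed

lemma Cauchy_Schwarz: "norm (ip x y) \<le> norm x * norm y"
proof (cases "y = 0")
  case False
  have "0 \<le> (norm x)\<^sup>2 - (norm (ip x y))\<^sup>2 / (norm y)\<^sup>2"
    by (simp flip: norm_subtract_component[OF False])
  with False have "(norm (ip x y))\<^sup>2 \<le> (norm x * norm y)\<^sup>2"
    by (simp add: field_simps power_mult_distrib)
  then show ?thesis by (rule power2_le_imp_le) simp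
qed simp

lemma bounded_linear_ip_right: "bounded_linear (ip x)"
proof
  fix r y show "ip x (r *\<^sub>R y) = r *\<^sub>R ip x y"
    using ip_scale_right[of x "of_real r" y] by (simp add: scale_of_real scaleR_conv_of_real)
  show "\<exists>K. \<forall>y. norm (ip x y) \<le> norm y * K"
    using Cauchy_Schwarz[of x] by (metis mult.commute)
qed (auto simp: ip_add_right)

lemma bounded_linear_scale: "bounded_linear (scale c)"
proof
  fix r x show "scale c (r *\<^sub>R x) = r *\<^sub>R scale c x"
    by (metis mult.commute scale_of_real scale_scale)
  show "\<exists>K. \<forall>x. norm (scale c x) \<le> norm x * K"
    by (metis mult.commute norm_scale order_refl)
qed (simp add: scale_right_distrib)

lemma parallelogram:
  fixes x y :: 'a
  shows "(norm (x + y))\<^sup>2 + (norm (x - y))\<^sup>2 = 2 * (norm x)\<^sup>2 + 2 * (norm y)\<^sup>2"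
proof -
  have "ip (x + y) (x + y) + ip (x - y) (x - y) = 2 * ip x x + 2 * ip y y"
    by (simp add: ip_add_left ip_add_right ip_diff_left ip_diff_right)
  then have "(of_real ((norm (x + y))\<^sup>2 + (norm (x - y))\<^sup>2) :: 'k)
      = of_real (2 * (norm x)\<^sup>2 + 2 * (norm y)\<^sup>2)"
    by (simp only: ip_self of_real_add of_real_mult of_real_numeral)
  then show ?thesis by (simp only: of_real_eq_iff)
qed

lemma subspace_orth_compl: "subspace (orth_compl ip S)"
  by (auto simp: subspace_def orth_compl_def ip_add_left ip_scale_left)

lemma subspace_closure:
  assumes "subspace S"
  shows "subspace (closure S)"
proof -
  have scl: "scale c x \<in> closure S" if x: "x \<in> closure S" for c x
  proof -
    obtain s where s: "\<And>n. s n \<in> S" "s \<longlonglongrightarrow> x"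
      using x by (auto simp: closure_sequential)
    have "(\<lambda>n. scale c (s n)) \<longlonglongrightarrow> scale c x"
      by (rule bounded_linear.tendsto[OF bounded_linear_scale s(2)])
    moreover have "scale c (s n) \<in> S" for n by (rule subspace_scale[OF assms s(1)])
    ultimately show ?thesis
      unfolding closure_sequential by (intro exI[of _ "\<lambda>n. scale c (s n)"]) simp
  qed
  have add: "x + x' \<in> closure S" if xx: "x \<in> closure S" "x' \<in> closure S" for x x'
  proof -
    obtain s s' where s: "\<And>n. s n \<in> S" "s \<longlonglongrightarrow> x" and s': "\<And>n. s' n \<in> S" "s' \<longlonglongrightarrow> x'"
      using xx unfolding closure_sequential by blast
    have "s n + s' n \<in> S" for n by (rule subspace_add[OF assms s(1) s'(1)])
    then show ?thesis
      using tendsto_add[OF s(2) s'(2)] unfolding closure_sequential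
      by (intro exI[of _ "\<lambda>n. s n + s' n"]) simp
  qed
  show ?thesis
    using scl add subsetD[OF closure_subset subspace_0[OF assms]] by (auto simp: subspace_def)
qed

lemma orthogonal_closure:
  assumes "\<And>s. s \<in> S \<Longrightarrow> ip x s = 0" and "z \<in> closure S"
  shows "ip x z = 0"
proof -
  obtain s where s: "\<And>n. s n \<in> S" "s \<longlonglongrightarrow> z" using assms(2) by (auto simp: closure_sequential)
  have "(\<lambda>n. ip x (s n)) \<longlonglongrightarrow> ip x z"
    by (rule bounded_linear.tendsto[OF bounded_linear_ip_right s(2)])
  then show ?thesis using s(1) assms(1) by (simp add: LIMSEQ_const_iff)
qed

text \<open>A minimizing sequence for the distance is Cauchy by the parallelogram law, because midpoints stay
  in \<open>S\<close>; its limit is a best approximation. A residual with a component along some \<open>z\<close> in \<open>S\<close> could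
  be shortened by subtracting it.\<close>

lemma projection_exists:
  assumes S: "subspace S" "closed S"
  obtains p where "p \<in> S" "x - p \<in> orth_compl ip S"
proof -
  define d where "d = infdist x S"
  have S0: "S \<noteq> {}" using subspace_0[OF S(1)] by auto
  have d_le: "d \<le> norm (x - s)" if "s \<in> S" for s
    using infdist_le[OF that, of x] by (simp add: d_def dist_norm)
  have d0: "0 \<le> d" by (simp add: d_def infdist_nonneg)
  have "\<exists>s\<in>S. (norm (x - s))\<^sup>2 < d\<^sup>2 + 1 / real (Suc n)" for n
  proof -
    have "d < sqrt (d\<^sup>2 + 1 / real (Suc n))"
      by (rule real_less_rsqrt) simp
    then obtain s where s: "s \<in> S" "norm (x - s) < sqrt (d\<^sup>2 + 1 / real (Suc n))"
      unfolding d_def infdist_notempty[OF S0]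
      by (subst (asm) cINF_less_iff[OF S0]) (auto simp: dist_norm intro!: bdd_belowI[of _ 0])
    have "(norm (x - s))\<^sup>2 < (sqrt (d\<^sup>2 + 1 / real (Suc n)))\<^sup>2"
      using s(2) by (rule power_strict_mono) auto
    also have "\<dots> = d\<^sup>2 + 1 / real (Suc n)" by (rule real_sqrt_pow2) simp
    finally show ?thesis using s(1) by blast
  qed
  then obtain s where s: "\<And>n. s n \<in> S" "\<And>n. (norm (x - s n))\<^sup>2 < d\<^sup>2 + 1 / real (Suc n)"
    by metis
  have close: "(norm (s m - s n))\<^sup>2 \<le> 2 / real (Suc m) + 2 / real (Suc n)" for m n
  proof -
    define h where "h = (1/2::real) *\<^sub>R (s m + s n)"
    have "h \<in> S"
      using subspace_scale[OF S(1) subspace_add[OF S(1) s(1)[of m] s(1)[of n]], of "of_real (1/2)"]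
      unfolding h_def by (simp only: scale_of_real)
    have e: "(x - s m) + (x - s n) = 2 *\<^sub>R (x - h)"
      by (simp add: h_def algebra_simps scaleR_2)
    have "4 * (norm (x - h))\<^sup>2 + (norm (s m - s n))\<^sup>2
        = 2 * (norm (x - s m))\<^sup>2 + 2 * (norm (x - s n))\<^sup>2"
      using parallelogram[of "x - s m" "x - s n"] unfolding e
      by (simp add: power_mult_distrib norm_minus_commute)
    moreover have "d\<^sup>2 \<le> (norm (x - h))\<^sup>2"
      using d_le[OF \<open>h \<in> S\<close>] d0 by (rule power_mono)
    ultimately show ?thesis using s(2)[of m] s(2)[of n] by linarith
  qed
  have "Cauchy s"
  proof (rule metric_CauchyI)
    fix e :: real assume "0 < e"
    then obtain M where M: "0 < M" "4 / e\<^sup>2 < real M"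
      using reals_Archimedean2[of "4 / e\<^sup>2"] by (metis of_nat_0_less_iff order_le_less_trans
          divide_nonneg_nonneg zero_le_numeral zero_le_power2)
    have "dist (s m) (s n) < e" if "m \<ge> M" "n \<ge> M" for m n
    proof -
      have r: "2 / real (Suc k) < e\<^sup>2 / 2" if "k \<ge> M" for k
      proof -
        have "4 / e\<^sup>2 < real (Suc k)" using M(2) that by linarith
        then show ?thesis using \<open>0 < e\<close> by (simp add: field_simps)
      qed
      have "(norm (s m - s n))\<^sup>2 < e\<^sup>2"
        using close[of m n] r[OF that(1)] r[OF that(2)] by linarith
      then show ?thesis
        unfolding dist_norm by (rule power2_less_imp_less) (use \<open>0 < e\<close> in simp)
    qed
    then show "\<exists>M. \<forall>m\<ge>M. \<forall>n\<ge>M. dist (s m) (s n) < e" by blast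
  qed
  then obtain p where p: "s \<longlonglongrightarrow> p" using Cauchy_convergent_iff convergent_def by blast
  have pS: "p \<in> S" by (rule closed_sequentially[OF S(2) s(1) p])
  have pd: "(norm (x - p))\<^sup>2 \<le> d\<^sup>2"
  proof (rule LIMSEQ_le)
    show "(\<lambda>n. (norm (x - s n))\<^sup>2) \<longlonglongrightarrow> (norm (x - p))\<^sup>2" by (intro tendsto_intros p)
    show "(\<lambda>n. d\<^sup>2 + 1 / real (Suc n)) \<longlonglongrightarrow> d\<^sup>2"
      using tendsto_add[OF tendsto_const LIMSEQ_inverse_real_of_nat, of "d\<^sup>2"]
      by (simp add: inverse_eq_divide)
    show "\<exists>N. \<forall>n\<ge>N. (norm (x - s n))\<^sup>2 \<le> d\<^sup>2 + 1 / real (Suc n)"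
      using s(2) less_imp_le by blast
  qed
  have "ip (x - p) z = 0" if z: "z \<in> S" for z
  proof (cases "z = 0")
    case False
    define c where "c = ip (x - p) z / of_real ((norm z)\<^sup>2)"
    have "p + scale c z \<in> S" by (intro subspace_add subspace_scale S pS z)
    then have "d\<^sup>2 \<le> (norm (x - (p + scale c z)))\<^sup>2" by (intro power_mono d_le d0)
    also have "x - (p + scale c z) = x - p - scale c z" by simp
    also have "(norm \<dots>)\<^sup>2 = (norm (x - p))\<^sup>2 - (norm (ip (x - p) z))\<^sup>2 / (norm z)\<^sup>2"
      unfolding c_def by (rule norm_subtract_component[OF False])
    finally have "(norm (ip (x - p) z))\<^sup>2 / (norm z)\<^sup>2 \<le> 0" using pd by linarith
    then show ?thesis using False by (simp add: divide_le_0_iff)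
  qed simp
  then show thesis using that pS by (simp add: orth_compl_def)
qed

end

section \<open>Bessel families\<close>

text \<open>The Bessel inequality is demanded on the whole space, whereas a frame only provides it on its own
  subspace: noisy data need not lie in the closure of the range, but their coefficients must be controlled.\<close>

definition bessel_bound ::
  "('a::banach \<Rightarrow> 'a \<Rightarrow> 'k::scalar_field) \<Rightarrow> 'i set \<Rightarrow> ('i \<Rightarrow> 'a) \<Rightarrow> real \<Rightarrow> bool" where
  "bessel_bound ip I w B \<longleftrightarrow> 0 < B \<and>
     (\<forall>F x. finite F \<longrightarrow> F \<subseteq> I \<longrightarrow> (\<Sum>i\<in>F. (norm (ip x (w i)))\<^sup>2) \<le> B * (norm x)\<^sup>2)"

context hilbert_space
begin

text \<open>Duality of analysis and synthesis: pairing \<open>T\<close> with itself turns the Bessel inequality at the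
  single vector \<open>T\<close> into a bound for \<open>T\<close>, by the Cauchy--Schwarz inequality for sums. Only this
  instance is assumed, so that the lemma applies before the Bessel inequality is known outside the
  subspace of a frame.\<close>

lemma synthesis_norm_le:
  assumes "0 < B" and T: "T = (\<Sum>i\<in>F. scale (c i) (w i))"
    and B: "(\<Sum>i\<in>F. (norm (ip T (w i)))\<^sup>2) \<le> B * (norm T)\<^sup>2"
  shows "(norm T)\<^sup>2 \<le> B * (\<Sum>i\<in>F. (norm (c i))\<^sup>2)"
proof (cases "T = 0")
  case True
  with \<open>0 < B\<close> show ?thesis by (simp add: sum_nonneg)
next
  case False
  have "(norm T)\<^sup>2 = norm (ip T T)" by (simp add: ip_self norm_power)
  also have "ip T T = (\<Sum>i\<in>F. c i * ip (w i) T)"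
    by (subst (1) T) (simp add: ip_sum_left ip_scale_left)
  also have "norm \<dots> \<le> (\<Sum>i\<in>F. norm (c i) * norm (ip T (w i)))"
    by (rule sum_norm_le) (simp add: norm_mult norm_ip_commute)
  finally have "((norm T)\<^sup>2)\<^sup>2 \<le> (\<Sum>i\<in>F. norm (c i) * norm (ip T (w i)))\<^sup>2"
    by (rule power_mono) simp
  also have "\<dots> \<le> (\<Sum>i\<in>F. (norm (c i))\<^sup>2) * (\<Sum>i\<in>F. (norm (ip T (w i)))\<^sup>2)"
    by (rule Cauchy_Schwarz_ineq_sum)
  also have "\<dots> \<le> (\<Sum>i\<in>F. (norm (c i))\<^sup>2) * (B * (norm T)\<^sup>2)"
    by (rule mult_left_mono[OF B]) (simp add: sum_nonneg)
  finally have "(norm T)\<^sup>2 * (norm T)\<^sup>2 \<le> (B * (\<Sum>i\<in>F. (norm (c i))\<^sup>2)) * (norm T)\<^sup>2"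
    by (simp only: power2_eq_square[of "(norm T)\<^sup>2"] ac_simps)
  then show ?thesis by (rule mult_right_le_imp_le) (use False in simp)
qed

text \<open>The upper frame bound extends from \<open>U\<close> to the whole space without projecting onto \<open>U\<close>. The partial
  sum \<open>T = \<Sum>\<^sub>i \<langle>x, w\<^sub>i\<rangle> w\<^sub>i\<close> lies in \<open>U\<close>, and \<open>S = \<Sum>\<^sub>i |\<langle>x, w\<^sub>i\<rangle>|\<^sup>2\<close> equals \<open>\<langle>x, T\<rangle>\<close>; hence
  \<open>S\<^sup>2 \<le> \<parallel>x\<parallel>\<^sup>2 \<parallel>T\<parallel>\<^sup>2 \<le> \<parallel>x\<parallel>\<^sup>2 B S\<close>.\<close>

lemma frame_imp_bessel_bound:
  assumes fr: "frame ip U I w" and U: "subspace U"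
  obtains B where "bessel_bound ip I w B"
proof -
  obtain B where B: "0 < B"
    "\<And>x. x \<in> U \<Longrightarrow> (\<lambda>i. (norm (ip (w i) x))\<^sup>2) summable_on I"
    "\<And>x. x \<in> U \<Longrightarrow> (\<Sum>\<^sub>\<infinity>i\<in>I. (norm (ip (w i) x))\<^sup>2) \<le> B * (norm x)\<^sup>2"
    and wU: "\<And>i. i \<in> I \<Longrightarrow> w i \<in> U"
    using fr unfolding frame_def by blast
  have "(\<Sum>i\<in>F. (norm (ip x (w i)))\<^sup>2) \<le> B * (norm x)\<^sup>2" if F: "finite F" "F \<subseteq> I" for F x
  proof -
    define S where "S = (\<Sum>i\<in>F. (norm (ip x (w i)))\<^sup>2)"
    define T where "T = (\<Sum>i\<in>F. scale (ip x (w i)) (w i))"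
    have "T \<in> U"
      unfolding T_def using F wU by (intro subspace_sum[OF U] subspace_scale[OF U]) auto
    have "(\<Sum>i\<in>F. (norm (ip T (w i)))\<^sup>2) = (\<Sum>i\<in>F. (norm (ip (w i) T))\<^sup>2)"
      by (simp add: norm_ip_commute)
    also have "\<dots> \<le> (\<Sum>\<^sub>\<infinity>i\<in>I. (norm (ip (w i) T))\<^sup>2)"
      by (rule finite_sum_le_infsum[OF B(2)[OF \<open>T \<in> U\<close>] F]) simp
    also have "\<dots> \<le> B * (norm T)\<^sup>2" by (rule B(3)[OF \<open>T \<in> U\<close>])
    finally have "(norm T)\<^sup>2 \<le> B * S"
      unfolding S_def by (rule synthesis_norm_le[OF B(1) T_def])
    have S0: "0 \<le> S" by (simp add: S_def sum_nonneg)
    have "ip x T = of_real S"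
      by (simp add: T_def S_def ip_sum_right ip_scale_right mult_kcnj mult.commute[of "kcnj _"])
    then have "S = norm (ip x T)" using S0 by simp
    also have "\<dots> \<le> norm x * norm T" by (rule Cauchy_Schwarz)
    finally have "S\<^sup>2 \<le> (norm x * norm T)\<^sup>2" using S0 by (rule power_mono)
    also have "\<dots> \<le> (norm x)\<^sup>2 * (B * S)"
      unfolding power_mult_distrib by (rule mult_left_mono[OF \<open>(norm T)\<^sup>2 \<le> B * S\<close>]) simp
    finally have "S * S \<le> (B * (norm x)\<^sup>2) * S" by (simp add: power2_eq_square ac_simps)
    then show ?thesis
      unfolding S_def[symmetric] using S0 \<open>0 < B\<close> by (cases "S = 0") auto
  qed
  with \<open>0 < B\<close> have "bessel_bound ip I w B" by (simp add: bessel_bound_def)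
  then show thesis by (rule that)
qed

lemma bessel_coefficients_square_summable:
  assumes w: "bessel_bound ip I w B"
  shows "(\<lambda>i. (norm (ip x (w i)))\<^sup>2) summable_on I"
    and "(\<Sum>\<^sub>\<infinity>i\<in>I. (norm (ip x (w i)))\<^sup>2) \<le> B * (norm x)\<^sup>2"
proof -
  have b: "(\<Sum>i\<in>F. (norm (ip x (w i)))\<^sup>2) \<le> B * (norm x)\<^sup>2" if "finite F" "F \<subseteq> I" for F
    using w that by (simp add: bessel_bound_def)
  show s: "(\<lambda>i. (norm (ip x (w i)))\<^sup>2) summable_on I"
    by (rule nonneg_bdd_above_summable_on) (use b in \<open>auto intro!: bdd_aboveI2\<close>)
  show "(\<Sum>\<^sub>\<infinity>i\<in>I. (norm (ip x (w i)))\<^sup>2) \<le> B * (norm x)\<^sup>2"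
    by (rule infsum_le_finite_sums[OF s b])
qed

text \<open>The finite estimate, applied to the part of a partial sum outside a large finite set, makes the net
  of partial sums Cauchy; the norm bound passes to the limit. The convergence is in general not
  absolute.\<close>

lemma bessel_synthesis:
  assumes w: "bessel_bound ip I w B"
    and c: "(\<lambda>i. (norm (c i))\<^sup>2) summable_on I"
  shows "(\<lambda>i. scale (c i) (w i)) summable_on I"
    and "(norm (\<Sum>\<^sub>\<infinity>i\<in>I. scale (c i) (w i)))\<^sup>2 \<le> B * (\<Sum>\<^sub>\<infinity>i\<in>I. (norm (c i))\<^sup>2)"
proof -
  define s where "s F = (\<Sum>i\<in>F. scale (c i) (w i))" for F
  define q where "q F = (\<Sum>i\<in>F. (norm (c i))\<^sup>2)" for F
  define Q where "Q = (\<Sum>\<^sub>\<infinity>i\<in>I. (norm (c i))\<^sup>2)"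
  have "0 < B" using w by (simp add: bessel_bound_def)
  have s_le: "(norm (s F))\<^sup>2 \<le> B * q F" if "finite F" "F \<subseteq> I" for F
    unfolding q_def using w that \<open>0 < B\<close>
    by (intro synthesis_norm_le[OF _ s_def]) (auto simp: bessel_bound_def)
  have q_le: "q F \<le> Q" if "finite F" "F \<subseteq> I" for F
    unfolding q_def Q_def by (rule finite_sum_le_infsum[OF c that]) simp
  have "\<exists>P. eventually P (finite_subsets_at_top I) \<and>
          (\<forall>F F'. P F \<and> P F' \<longrightarrow> dist (s F) (s F') < e)" if "0 < e" for e
  proof -
    have "0 < (e/2)\<^sup>2 / (2 * B)" using \<open>0 < e\<close> \<open>0 < B\<close> by simp
    then obtain F0 where F0: "finite F0" "F0 \<subseteq> I" "dist (q F0) Q \<le> (e/2)\<^sup>2 / (2 * B)"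
      using infsum_finite_approximation[OF c] unfolding q_def Q_def by blast
    define P where "P F \<longleftrightarrow> finite F \<and> F0 \<subseteq> F \<and> F \<subseteq> I" for F
    have near: "dist (s F) (s F0) < e / 2" if "P F" for F
    proof -
      have F: "finite F" "F0 \<subseteq> F" "F \<subseteq> I" using that by (auto simp: P_def)
      have "s F - s F0 = s (F - F0)" "q F - q F0 = q (F - F0)"
        unfolding s_def q_def using F by (simp_all add: sum_diff)
      then have "(dist (s F) (s F0))\<^sup>2 \<le> B * (q F - q F0)"
        using s_le[of "F - F0"] F by (auto simp: dist_norm)
      also have "\<dots> \<le> B * ((e/2)\<^sup>2 / (2 * B))"
        using F0(3) q_le[OF F(1,3)] \<open>0 < B\<close> by (intro mult_left_mono) (auto simp: dist_real_def)
      also have "\<dots> < (e/2)\<^sup>2" using \<open>0 < B\<close> \<open>0 < e\<close> by simp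
      finally show ?thesis by (rule power2_less_imp_less) (use \<open>0 < e\<close> in simp)
    qed
    have "dist (s F) (s F') < e" if "P F" "P F'" for F F'
      using dist_triangle2[of "s F" "s F'" "s F0"] near[OF that(1)] near[OF that(2)] by linarith
    moreover have "eventually P (finite_subsets_at_top I)"
      unfolding eventually_finite_subsets_at_top P_def using F0(1,2) by blast
    ultimately show ?thesis by blast
  qed
  then have "cauchy_filter (filtermap s (finite_subsets_at_top I))"
    by (simp add: cauchy_filter_metric_filtermap)
  moreover have "complete (UNIV :: 'a set)"
    by (meson Cauchy_convergent UNIV_I complete_def convergent_def)
  ultimately obtain L where L: "(s \<longlongrightarrow> L) (finite_subsets_at_top I)"
    using complete_uniform[where S = "UNIV :: 'a set"] by (force simp add: filterlim_def)
  then have hs: "((\<lambda>i. scale (c i) (w i)) has_sum L) I"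
    unfolding has_sum_def s_def .
  then show "(\<lambda>i. scale (c i) (w i)) summable_on I" by (rule has_sum_imp_summable)
  have "(norm L)\<^sup>2 \<le> B * Q"
  proof (rule tendsto_upperbound)
    show "((\<lambda>F. (norm (s F))\<^sup>2) \<longlongrightarrow> (norm L)\<^sup>2) (finite_subsets_at_top I)"
      by (intro tendsto_intros L)
    have "(norm (s F))\<^sup>2 \<le> B * Q" if "finite F \<and> F \<subseteq> I" for F
      using s_le[of F] q_le[of F] that \<open>0 < B\<close>
      by (meson mult_left_mono less_imp_le order_trans)
    then show "\<forall>\<^sub>F F in finite_subsets_at_top I. (norm (s F))\<^sup>2 \<le> B * Q"
      by (intro eventually_finite_subsets_at_top_weakI) simp
  qed simp
  then show "(norm (\<Sum>\<^sub>\<infinity>i\<in>I. scale (c i) (w i)))\<^sup>2 \<le> B * (\<Sum>\<^sub>\<infinity>i\<in>I. (norm (c i))\<^sup>2)"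
    using infsumI[OF hs] by (simp add: Q_def)
qed

end

section \<open>Dominated convergence for sums\<close>

text \<open>Dominated convergence for a general filter: the sum splits into a finite part, which tends to
  \<open>0\<close> termwise, and a tail of \<open>g\<close> that is small uniformly in \<open>\<alpha>\<close>.\<close>

lemma infsum_dominated_tendsto_0:
  fixes g :: "'i \<Rightarrow> real" and t :: "'a \<Rightarrow> 'i \<Rightarrow> real"
  assumes g: "g summable_on I" "\<And>i. i \<in> I \<Longrightarrow> 0 \<le> g i"
    and t: "\<And>i. i \<in> I \<Longrightarrow> ((\<lambda>\<alpha>. t \<alpha> i) \<longlongrightarrow> 0) F"
    and bnd: "\<forall>\<^sub>F \<alpha> in F. \<forall>i\<in>I. 0 \<le> t \<alpha> i \<and> t \<alpha> i \<le> M"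
  shows "((\<lambda>\<alpha>. \<Sum>\<^sub>\<infinity>i\<in>I. t \<alpha> i * g i) \<longlongrightarrow> 0) F"
proof (rule tendstoI)
  fix e :: real assume "0 < e"
  \<comment> \<open>A positive bound to divide by: \<open>M\<close> may vanish, and may be negative, for instance if \<open>I\<close> is empty.\<close>
  define M' where "M' = \<bar>M\<bar> + 1"
  have "0 < M'" by (simp add: M'_def)
  then have "0 < e / (2 * M')" using \<open>0 < e\<close> by simp
  then obtain E where E: "finite E" "E \<subseteq> I" "dist (sum g E) (infsum g I) \<le> e / (2 * M')"
    using infsum_finite_approximation[OF g(1)] by blast
  have "((\<lambda>\<alpha>. \<Sum>i\<in>E. t \<alpha> i * g i) \<longlongrightarrow> (\<Sum>i\<in>E. 0 * g i)) F"
    using E(2) by (intro tendsto_intros t) auto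
  then have "\<forall>\<^sub>F \<alpha> in F. (\<Sum>i\<in>E. t \<alpha> i * g i) < e / 2"
    using \<open>0 < e\<close> by (intro order_tendstoD) auto
  with bnd show "\<forall>\<^sub>F \<alpha> in F. dist (\<Sum>\<^sub>\<infinity>i\<in>I. t \<alpha> i * g i) 0 < e"
  proof eventually_elim
    case (elim \<alpha>)
    then have t0: "0 \<le> t \<alpha> i" and tM: "t \<alpha> i \<le> M'" if "i \<in> I" for i
      using that by (force simp: M'_def)+
    have le: "t \<alpha> i * g i \<le> M' * g i" and nn: "0 \<le> t \<alpha> i * g i" if "i \<in> I" for i
      using t0[OF that] tM[OF that] g(2)[OF that] by (auto intro: mult_right_mono)
    have sm: "(\<lambda>i. t \<alpha> i * g i) summable_on I"
      by (rule summable_on_comparison_test[OF summable_on_cmult_right[OF g(1)] le nn])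
    have "(\<Sum>i\<in>G. t \<alpha> i * g i) \<le> (\<Sum>i\<in>E. t \<alpha> i * g i) + M' * (infsum g I - sum g E)"
      if G: "finite G" "G \<subseteq> I" for G
    proof -
      have "(\<Sum>i\<in>G. t \<alpha> i * g i) \<le> (\<Sum>i\<in>G \<union> E. t \<alpha> i * g i)"
        using G E nn by (intro sum_mono2) auto
      also have "\<dots> = (\<Sum>i\<in>E. t \<alpha> i * g i) + (\<Sum>i\<in>(G \<union> E) - E. t \<alpha> i * g i)"
        using G E by (subst sum.subset_diff[of E]) auto
      also have "(\<Sum>i\<in>(G \<union> E) - E. t \<alpha> i * g i) \<le> M' * (\<Sum>i\<in>(G \<union> E) - E. g i)"
        unfolding sum_distrib_left using G E le by (intro sum_mono) auto
      also have "(\<Sum>i\<in>(G \<union> E) - E. g i) = sum g (G \<union> E) - sum g E"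
        using G E by (intro sum_diff) auto
      also have "sum g (G \<union> E) \<le> infsum g I"
        using G E g by (intro finite_sum_le_infsum) auto
      finally show ?thesis using \<open>0 < M'\<close> by simp
    qed
    then have "(\<Sum>\<^sub>\<infinity>i\<in>I. t \<alpha> i * g i) \<le> (\<Sum>i\<in>E. t \<alpha> i * g i) + M' * (infsum g I - sum g E)"
      by (rule infsum_le_finite_sums[OF sm])
    also have "M' * (infsum g I - sum g E) \<le> M' * (e / (2 * M'))"
      using E(3) \<open>0 < M'\<close> by (intro mult_left_mono) (auto simp: dist_real_def)
    also have "\<dots> = e / 2" using \<open>0 < M'\<close> by simp
    finally have "(\<Sum>\<^sub>\<infinity>i\<in>I. t \<alpha> i * g i) < e" using elim(2) by linarith
    moreover have "0 \<le> (\<Sum>\<^sub>\<infinity>i\<in>I. t \<alpha> i * g i)" by (rule infsum_nonneg) (rule nn)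
    ultimately show ?case by simp
  qed
qed


section \<open>The Moore--Penrose solution of a closed operator\<close>

lemma (in hilbert_space) orth_proj_eqI:
  assumes S: "subspace S" and p: "p \<in> S" "y - p \<in> orth_compl ip S"
  shows "orth_proj ip S y = p"
  unfolding orth_proj_def
proof (rule the_equality)
  fix q assume q: "q \<in> S \<and> y - q \<in> orth_compl ip S"
  then have "p - q \<in> S" using p(1) subspace_diff[OF S] by blast
  then have "ip (y - q) (p - q) = 0" "ip (y - p) (p - q) = 0"
    using p(2) q by (auto simp: orth_compl_def)
  then have "ip ((y - q) - (y - p)) (p - q) = 0"
    by (simp add: ip_diff_left)
  then have "ip (p - q) (p - q) = 0" by simp
  then show "q = p" by (simp add: ip_self)
qed (use p in blast)

locale closed_dense_hilbert_operator =
  X: hilbert_space scaleX ipX + Y: hilbert_space scaleY ipY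
  for scaleX :: "'k::scalar_field \<Rightarrow> 'x::banach \<Rightarrow> 'x" and ipX :: "'x \<Rightarrow> 'x \<Rightarrow> 'k"
    and scaleY :: "'k \<Rightarrow> 'y::banach \<Rightarrow> 'y" and ipY :: "'y \<Rightarrow> 'y \<Rightarrow> 'k" +
  fixes D :: "'x set" and K :: "'x \<Rightarrow> 'y"
  assumes closed_dense: "closed_dense_operator scaleX scaleY D K"
begin

lemma subspace_D: "X.subspace D"
  and K_add: "x \<in> D \<Longrightarrow> x' \<in> D \<Longrightarrow> K (x + x') = K x + K x'"
  and K_scale: "x \<in> D \<Longrightarrow> K (scaleX c x) = scaleY c (K x)"
  and dense_D: "closure D = UNIV"
  and closed_graph: "closed ((\<lambda>x. (x, K x)) ` D)"
  using closed_dense unfolding closed_dense_operator_def by blast+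

lemma K_diff:
  assumes "x \<in> D" "x' \<in> D"
  shows "K (x - x') = K x - K x'"
proof -
  have "x - x' \<in> D" by (rule X.subspace_diff[OF subspace_D assms])
  then have "K (x - x') + K x' = K x" using K_add[of "x - x'" x'] assms by simp
  then show ?thesis by (simp add: algebra_simps)
qed

lemma subspace_ker: "X.subspace (op_ker D K)"
proof -
  have "K 0 = 0" using K_diff[of 0 0] X.subspace_0[OF subspace_D] by simp
  then show ?thesis
    using subspace_D unfolding X.subspace_def op_ker_def by (auto simp: K_add K_scale)
qed

lemma subspace_ran: "Y.subspace (op_ran D K)"
proof -
  have "K 0 = 0" using K_diff[of 0 0] X.subspace_0[OF subspace_D] by simp
  then have "0 \<in> op_ran D K"
    using X.subspace_0[OF subspace_D] unfolding op_ran_def by (metis image_eqI)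
  moreover have "K x + K x' \<in> op_ran D K" if "x \<in> D" "x' \<in> D" for x x'
    unfolding op_ran_def K_add[OF that, symmetric]
    by (rule imageI) (rule X.subspace_add[OF subspace_D that])
  moreover have "scaleY c (K x) \<in> op_ran D K" if "x \<in> D" for c x
    unfolding op_ran_def K_scale[OF that, symmetric]
    by (rule imageI) (rule X.subspace_scale[OF subspace_D that])
  ultimately show ?thesis unfolding Y.subspace_def by (auto simp: op_ran_def)
qed

text \<open>The kernel is the section of the closed graph at \<open>0\<close>.\<close>

lemma closed_ker: "closed (op_ker D K)"
proof -
  have "op_ker D K = (\<lambda>x. (x, 0)) -` ((\<lambda>x. (x, K x)) ` D)"
    by (auto simp: op_ker_def)
  moreover have "closed \<dots>"
    by (intro closed_vimage closed_graph continuous_intros)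
  ultimately show ?thesis by simp
qed

text \<open>The description in the definition of \<open>adj\<close> is unique because the domain is dense.\<close>

lemma adj_eq:
  assumes "w \<in> adj_dom ipX ipY D K" and "x \<in> D"
  shows "ipY (K x) w = ipX x (adj ipX ipY D K w)"
proof -
  obtain h where h: "\<forall>x\<in>D. ipY (K x) w = ipX x h"
    using assms(1) by (auto simp: adj_dom_def)
  have "adj ipX ipY D K w = h"
    unfolding adj_def
  proof (rule the_equality)
    fix h' assume h': "\<forall>x\<in>D. ipY (K x) w = ipX x h'"
    have "ipX (h' - h) x = 0" if "x \<in> D" for x
    proof -
      have "ipX x (h' - h) = 0" using h h' that by (simp add: X.ip_diff_right)
      then show ?thesis by (simp add: X.ip_eq_0_commute[of "h' - h"])
    qed
    moreover have "h' - h \<in> closure D" by (simp add: dense_D)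
    ultimately have "ipX (h' - h) (h' - h) = 0" by (rule X.orthogonal_closure)
    then show "h' = h" by (simp add: X.ip_self)
  qed (rule h)
  with h assms(2) show ?thesis by simp
qed

text \<open>If \<open>y = K x\<^sub>0 + b\<close> with \<open>b\<close> orthogonal to the range, then the projection of \<open>y\<close> to the
  closure of the range is \<open>K x\<^sub>0\<close>, and removing from \<open>x\<^sub>0\<close> its projection to the kernel yields the solution in the
  orthogonal complement of the kernel. The kernel lies in the domain, so the solution does too.\<close>

lemma mp_inv_solves:
  assumes y: "y \<in> mp_dom ipY D K"
  shows "mp_inv ipX ipY D K y \<in> D"
    and "mp_inv ipX ipY D K y \<in> orth_compl ipX (op_ker D K)"
    and "y - K (mp_inv ipX ipY D K y) \<in> orth_compl ipY (closure (op_ran D K))"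
proof -
  obtain x0 b where x0: "x0 \<in> D" and b: "b \<in> orth_compl ipY (op_ran D K)" and y_eq: "y = K x0 + b"
    using y by (auto simp: mp_dom_def op_ran_def)
  have b': "b \<in> orth_compl ipY (closure (op_ran D K))"
    using b Y.orthogonal_closure[of "op_ran D K" b] by (simp add: orth_compl_def)
  have "K x0 \<in> closure (op_ran D K)"
    using x0 by (intro subsetD[OF closure_subset]) (simp add: op_ran_def)
  then have proj: "orth_proj ipY (closure (op_ran D K)) y = K x0"
    using b' by (intro Y.orth_proj_eqI Y.subspace_closure subspace_ran) (auto simp: y_eq)
  obtain p where p: "p \<in> op_ker D K" "x0 - p \<in> orth_compl ipX (op_ker D K)"
    using X.projection_exists[OF subspace_ker closed_ker] by blast
  define x where "x = x0 - p"
  have x: "x \<in> D" "x \<in> orth_compl ipX (op_ker D K)" "K x = K x0"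
    using p x0 X.subspace_diff[OF subspace_D] unfolding x_def by (auto simp: op_ker_def K_diff)
  have "mp_inv ipX ipY D K y = x"
    unfolding mp_inv_def proj
  proof (rule the_equality)
    fix x' assume x': "x' \<in> D \<inter> orth_compl ipX (op_ker D K) \<and> K x' = K x0"
    have "x' - x \<in> orth_compl ipX (op_ker D K)"
      using x x' X.subspace_diff[OF X.subspace_orth_compl] by blast
    moreover have "x' - x \<in> op_ker D K"
      using x x' X.subspace_diff[OF subspace_D] by (auto simp: op_ker_def K_diff)
    ultimately have "ipX (x' - x) (x' - x) = 0" by (auto simp: orth_compl_def)
    then show "x' = x" by (simp add: X.ip_self)
  qed (use x in auto)
  with x b' show "mp_inv ipX ipY D K y \<in> D"
    "mp_inv ipX ipY D K y \<in> orth_compl ipX (op_ker D K)"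
    "y - K (mp_inv ipX ipY D K y) \<in> orth_compl ipY (closure (op_ran D K))"
    by (auto simp: y_eq)
qed

text \<open>This diagonalizes the problem: the data coefficients are those of the solution, multiplied by
  \<open>\<kappa>\<close>. The part of \<open>y\<close> orthogonal to the range is invisible to \<open>v\<close>.\<close>

lemma dfd_coefficient:
  assumes dfd: "dfd scaleX ipX ipY D K I u v \<kappa>" and y: "y \<in> mp_dom ipY D K" and i: "i \<in> I"
  shows "ipY y (v i) = of_real (\<kappa> i) * ipX (mp_inv ipX ipY D K y) (u i)"
proof -
  let ?x = "mp_inv ipX ipY D K y"
  have "v i \<in> closure (op_ran D K)" using dfd i by (auto simp: dfd_def frame_def)
  then have "ipY (y - K ?x) (v i) = 0" using mp_inv_solves(3)[OF y] by (auto simp: orth_compl_def)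
  then have "ipY y (v i) = ipY (K ?x) (v i)" by (simp add: Y.ip_diff_left)
  also have "\<dots> = ipX ?x (scaleX (of_real (\<kappa> i)) (u i))"
    using dfd i adj_eq[OF _ mp_inv_solves(1)[OF y], of "v i"] by (auto simp: dfd_def)
  finally show ?thesis by (simp add: X.ip_scale_right)
qed

end

section \<open>Stability and convergence of the filtered decomposition\<close>

lemma abs_le_filter_norm:
  assumes "bdd_above ((\<lambda>\<kappa>. \<bar>g \<kappa>\<bar>) ` {0<..})" "0 < k"
  shows "\<bar>g k\<bar> \<le> filter_norm g"
  unfolding filter_norm_def by (rule cSUP_upper[OF _ assms(1)]) (use assms(2) in simp)

locale filtered_decomposition = closed_dense_hilbert_operator scaleX ipX scaleY ipY D K
  for scaleX :: "'k::scalar_field \<Rightarrow> 'x::banach \<Rightarrow> 'x" and ipX :: "'x \<Rightarrow> 'x \<Rightarrow> 'k"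
    and scaleY :: "'k \<Rightarrow> 'y::banach \<Rightarrow> 'y" and ipY :: "'y \<Rightarrow> 'y \<Rightarrow> 'k"
    and D :: "'x set" and K :: "'x \<Rightarrow> 'y" +
  fixes I :: "'i set" and u u' :: "'i \<Rightarrow> 'x" and v :: "'i \<Rightarrow> 'y" and \<kappa> :: "'i \<Rightarrow> real"
    and f :: "real \<Rightarrow> real \<Rightarrow> real"
  assumes dfd: "dfd scaleX ipX ipY D K I u v \<kappa>"
    and dual: "dual_frame scaleX ipX (orth_compl ipX (op_ker D K)) I u u'"
    and filt: "regularizing_filter f"
begin

abbreviation R where "R \<equiv> filtered_dfd scaleX ipY f I u' v \<kappa>"
abbreviation Kinv where "Kinv \<equiv> mp_inv ipX ipY D K"

lemma \<kappa>_pos: "i \<in> I \<Longrightarrow> 0 < \<kappa> i"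
  using dfd by (simp add: dfd_def)

lemma filter_coefficient_le: "0 < \<alpha> \<Longrightarrow> i \<in> I \<Longrightarrow> \<bar>f \<alpha> (\<kappa> i)\<bar> \<le> filter_norm (f \<alpha>)"
  using filt by (intro abs_le_filter_norm) (auto simp: regularizing_filter_def \<kappa>_pos)

lemma synthesis_bessel_bound: obtains B where "bessel_bound ipX I u' B"
  using dual X.frame_imp_bessel_bound X.subspace_orth_compl unfolding dual_frame_def by metis

lemma analysis_bessel_bound: obtains B where "bessel_bound ipY I v B"
  using dfd Y.frame_imp_bessel_bound Y.subspace_closure[OF subspace_ran] unfolding dfd_def by metis

lemma filtered_coefficients_square_summable:
  assumes "0 < \<alpha>"
  shows "(\<lambda>i. (norm (of_real (f \<alpha> (\<kappa> i)) * ipY z (v i)))\<^sup>2) summable_on I"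
    and "bessel_bound ipY I v B \<Longrightarrow>
      (\<Sum>\<^sub>\<infinity>i\<in>I. (norm (of_real (f \<alpha> (\<kappa> i)) * ipY z (v i)))\<^sup>2) \<le> (filter_norm (f \<alpha>))\<^sup>2 * (B * (norm z)\<^sup>2)"
proof -
  let ?N = "filter_norm (f \<alpha>)"
  have le: "(norm (of_real (f \<alpha> (\<kappa> i)) * ipY z (v i)))\<^sup>2 \<le> ?N\<^sup>2 * (norm (ipY z (v i)))\<^sup>2"
    if "i \<in> I" for i
    using filter_coefficient_le[OF assms that] abs_le_square_iff[of "f \<alpha> (\<kappa> i)" ?N]
    by (auto simp: norm_mult power_mult_distrib intro!: mult_right_mono)
  show sm: "(\<lambda>i. (norm (of_real (f \<alpha> (\<kappa> i)) * ipY z (v i)))\<^sup>2) summable_on I"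
  proof -
    obtain B where "bessel_bound ipY I v B" by (rule analysis_bessel_bound)
    note s = Y.bessel_coefficients_square_summable(1)[OF this]
    show ?thesis
      by (rule summable_on_comparison_test[OF summable_on_cmult_right[OF s] le]) auto
  qed
  assume B: "bessel_bound ipY I v B"
  note s = Y.bessel_coefficients_square_summable[OF B, of z]
  have "(\<Sum>\<^sub>\<infinity>i\<in>I. (norm (of_real (f \<alpha> (\<kappa> i)) * ipY z (v i)))\<^sup>2)
      \<le> (\<Sum>\<^sub>\<infinity>i\<in>I. ?N\<^sup>2 * (norm (ipY z (v i)))\<^sup>2)"
    by (rule infsum_mono[OF sm summable_on_cmult_right[OF s(1)] le])
  also have "\<dots> = ?N\<^sup>2 * (\<Sum>\<^sub>\<infinity>i\<in>I. (norm (ipY z (v i)))\<^sup>2)" by (rule infsum_cmult_right')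
  also have "\<dots> \<le> ?N\<^sup>2 * (B * (norm z)\<^sup>2)" by (rule mult_left_mono[OF s(2)]) simp
  finally show "(\<Sum>\<^sub>\<infinity>i\<in>I. (norm (of_real (f \<alpha> (\<kappa> i)) * ipY z (v i)))\<^sup>2) \<le> ?N\<^sup>2 * (B * (norm z)\<^sup>2)" .
qed

lemma filtered_dfd_has_sum:
  assumes "0 < \<alpha>"
  shows "((\<lambda>i. scaleX (of_real (f \<alpha> (\<kappa> i)) * ipY z (v i)) (u' i)) has_sum R \<alpha> z) I"
proof -
  obtain B where "bessel_bound ipX I u' B" by (rule synthesis_bessel_bound)
  then show ?thesis
    unfolding filtered_dfd_def
    by (intro has_sum_infsum X.bessel_synthesis(1) filtered_coefficients_square_summable(1) assms)
qed

lemma filtered_dfd_diff: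
  assumes "0 < \<alpha>"
  shows "R \<alpha> (z - z') = R \<alpha> z - R \<alpha> z'"
proof -
  have "((\<lambda>i. scaleX (of_real (f \<alpha> (\<kappa> i)) * ipY (z - z') (v i)) (u' i)
            + scaleX (of_real (f \<alpha> (\<kappa> i)) * ipY z' (v i)) (u' i))
          has_sum R \<alpha> (z - z') + R \<alpha> z') I"
    by (intro has_sum_add filtered_dfd_has_sum assms)
  also have "(\<lambda>i. scaleX (of_real (f \<alpha> (\<kappa> i)) * ipY (z - z') (v i)) (u' i)
            + scaleX (of_real (f \<alpha> (\<kappa> i)) * ipY z' (v i)) (u' i))
      = (\<lambda>i. scaleX (of_real (f \<alpha> (\<kappa> i)) * ipY z (v i)) (u' i))"
    by (simp add: Y.ip_diff_left right_diff_distrib X.scale_left_diff_distrib)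
  finally have "R \<alpha> (z - z') + R \<alpha> z' = R \<alpha> z"
    using filtered_dfd_has_sum[OF assms] has_sum_unique by blast
  then show ?thesis by (simp add: algebra_simps)
qed

text \<open>Stability: \<open>R\<^sub>\<alpha>\<close> is analysis with \<open>v\<close>, multiplication by bounded factors, and synthesis with
  \<open>u'\<close>. The constant depends on the two Bessel bounds only, not on \<open>\<alpha>\<close>.\<close>

lemma filtered_dfd_bounded:
  obtains L where "0 \<le> L" "\<And>\<alpha> z. 0 < \<alpha> \<Longrightarrow> norm (R \<alpha> z) \<le> L * filter_norm (f \<alpha>) * norm z"
proof -
  obtain B where B: "bessel_bound ipX I u' B" by (rule synthesis_bessel_bound)
  obtain A where A: "bessel_bound ipY I v A" by (rule analysis_bessel_bound)
  have pos: "0 < A" "0 < B" using A B by (simp_all add: bessel_bound_def)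
  have "norm (R \<alpha> z) \<le> sqrt (A * B) * filter_norm (f \<alpha>) * norm z" if "0 < \<alpha>" for \<alpha> z
  proof (rule power2_le_imp_le)
    have "(norm (R \<alpha> z))\<^sup>2 \<le> B * (\<Sum>\<^sub>\<infinity>i\<in>I. (norm (of_real (f \<alpha> (\<kappa> i)) * ipY z (v i)))\<^sup>2)"
      unfolding filtered_dfd_def
      by (rule X.bessel_synthesis(2)[OF B filtered_coefficients_square_summable(1)[OF that]])
    also have "\<dots> \<le> B * ((filter_norm (f \<alpha>))\<^sup>2 * (A * (norm z)\<^sup>2))"
      using pos by (intro mult_left_mono filtered_coefficients_square_summable(2)[OF that A]) simp
    also have "\<dots> = (sqrt (A * B) * filter_norm (f \<alpha>) * norm z)\<^sup>2"
      using pos by (simp add: power_mult_distrib)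
    finally show "(norm (R \<alpha> z))\<^sup>2 \<le> (sqrt (A * B) * filter_norm (f \<alpha>) * norm z)\<^sup>2" .
    \<comment> \<open>The value at \<open>1\<close>, or at any other positive number, shows that the norm is nonnegative.\<close>
    have "\<bar>f \<alpha> 1\<bar> \<le> filter_norm (f \<alpha>)"
      using filt that by (intro abs_le_filter_norm) (auto simp: regularizing_filter_def)
    then show "0 \<le> sqrt (A * B) * filter_norm (f \<alpha>) * norm z"
      using pos by (intro mult_nonneg_nonneg) auto
  qed
  then show thesis using that[of "sqrt (A * B)"] pos by simp
qed

lemma continuous_on_filtered_dfd:
  assumes "0 < \<alpha>"
  shows "continuous_on UNIV (R \<alpha>)"
proof -
  obtain L where L: "norm (R \<alpha> z) \<le> L * filter_norm (f \<alpha>) * norm z" for z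
    using filtered_dfd_bounded assms by metis
  define M where "M = L * filter_norm (f \<alpha>)"
  have "isCont (R \<alpha>) z" for z
    unfolding isCont_def
  proof (rule Lim_null[THEN iffD2], rule Lim_null_comparison)
    show "\<forall>\<^sub>F z' in at z. norm (R \<alpha> z' - R \<alpha> z) \<le> M * norm (z' - z)"
      using L unfolding M_def by (simp flip: filtered_dfd_diff[OF assms])
    have "((\<lambda>z'. M * norm (z' - z)) \<longlongrightarrow> M * norm (z - z)) (at z)" by (intro tendsto_intros)
    then show "((\<lambda>z'. M * norm (z' - z)) \<longlongrightarrow> 0) (at z)" by simp
  qed
  then show ?thesis by (simp add: continuous_on_eq_continuous_at)
qed

text \<open>Exact data: the error has the coefficients \<open>(1 - \<kappa>\<^sub>i f\<^sub>\<alpha>(\<kappa>\<^sub>i)) \<langle>x, u\<^sub>i\<rangle>\<close> with respect to the dual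
  frame. The factors converge only pointwise in \<open>\<kappa>\<close>, hence the
  appeal to dominated convergence.\<close>

lemma filtered_dfd_exact_data_tendsto:
  assumes y: "y \<in> mp_dom ipY D K"
  shows "((\<lambda>\<alpha>. norm (Kinv y - R \<alpha> y)) \<longlongrightarrow> 0) (at_right 0)"
proof -
  obtain B where B: "bessel_bound ipX I u' B" by (rule synthesis_bessel_bound)
  obtain A where A: "bessel_bound ipX I u A"
    using dfd X.frame_imp_bessel_bound X.subspace_orth_compl unfolding dfd_def by metis
  obtain C where C: "0 < C" "\<And>\<alpha> k. 0 < \<alpha> \<Longrightarrow> 0 < k \<Longrightarrow> \<bar>k * f \<alpha> k\<bar> \<le> C"
    using filt unfolding regularizing_filter_def by blast
  define g where "g i = (norm (ipX (Kinv y) (u i)))\<^sup>2" for i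
  define t where "t \<alpha> i = (1 - \<kappa> i * f \<alpha> (\<kappa> i))\<^sup>2" for \<alpha> i
  have g: "g summable_on I"
    unfolding g_def by (rule X.bessel_coefficients_square_summable(1)[OF A])
  have tM: "t \<alpha> i \<le> (1 + C)\<^sup>2" if "0 < \<alpha>" "i \<in> I" for \<alpha> i
    using C(2)[OF that(1) \<kappa>_pos[OF that(2)]] unfolding t_def
    by (intro abs_le_square_iff[THEN iffD1]) linarith
  have dom: "((\<lambda>\<alpha>. \<Sum>\<^sub>\<infinity>i\<in>I. t \<alpha> i * g i) \<longlongrightarrow> 0) (at_right 0)"
  proof (rule infsum_dominated_tendsto_0[OF g])
    fix i assume "i \<in> I"
    then have "((\<lambda>\<alpha>. f \<alpha> (\<kappa> i)) \<longlongrightarrow> 1 / \<kappa> i) (at_right 0)"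
      using filt \<kappa>_pos by (simp add: regularizing_filter_def)
    then have "((\<lambda>\<alpha>. t \<alpha> i) \<longlongrightarrow> (1 - \<kappa> i * (1 / \<kappa> i))\<^sup>2) (at_right 0)"
      unfolding t_def by (intro tendsto_intros)
    then show "((\<lambda>\<alpha>. t \<alpha> i) \<longlongrightarrow> 0) (at_right 0)" using \<kappa>_pos[OF \<open>i \<in> I\<close>] by simp
  next
    show "\<forall>\<^sub>F \<alpha> in at_right 0. \<forall>i\<in>I. 0 \<le> t \<alpha> i \<and> t \<alpha> i \<le> (1 + C)\<^sup>2"
      using eventually_at_right_less[of "0::real"]
      by eventually_elim (use tM in \<open>auto simp: t_def\<close>)
  qed (simp add: g_def)
  have bound: "norm (Kinv y - R \<alpha> y) \<le> sqrt (B * (\<Sum>\<^sub>\<infinity>i\<in>I. t \<alpha> i * g i))" if "0 < \<alpha>" for \<alpha>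
  proof -
    define c where "c i = of_real (1 - \<kappa> i * f \<alpha> (\<kappa> i)) * ipX (Kinv y) (u i)" for i
    have cn: "(norm (c i))\<^sup>2 = t \<alpha> i * g i" for i
      unfolding c_def t_def g_def norm_mult norm_of_real power_mult_distrib by simp
    have "((\<lambda>i. scaleX (ipX (Kinv y) (u i)) (u' i)) has_sum Kinv y) I"
      using dual mp_inv_solves(2)[OF y] by (simp add: dual_frame_def)
    then have "((\<lambda>i. scaleX (ipX (Kinv y) (u i)) (u' i)
          + - scaleX (of_real (f \<alpha> (\<kappa> i)) * ipY y (v i)) (u' i)) has_sum Kinv y + - R \<alpha> y) I"
      using filtered_dfd_has_sum[OF that] by (intro has_sum_add) (simp_all add: has_sum_uminus)
    then have "((\<lambda>i. scaleX (c i) (u' i)) has_sum Kinv y + - R \<alpha> y) I"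
      by (rule has_sum_cong[THEN iffD1, rotated])
        (simp add: c_def dfd_coefficient[OF dfd y] algebra_simps flip: X.scale_left_diff_distrib)
    moreover have "(\<lambda>i. (norm (c i))\<^sup>2) summable_on I"
      unfolding cn
      by (rule summable_on_comparison_test[OF summable_on_cmult_right[OF g, of "(1 + C)\<^sup>2"]])
        (use tM[OF that] in \<open>auto simp: g_def t_def intro: mult_right_mono\<close>)
    ultimately have "(norm (Kinv y - R \<alpha> y))\<^sup>2 \<le> B * (\<Sum>\<^sub>\<infinity>i\<in>I. t \<alpha> i * g i)"
      using X.bessel_synthesis(2)[OF B, of c] by (simp add: infsumI cn)
    then show ?thesis by (rule real_le_rsqrt)
  qed
  show ?thesis
  proof (rule Lim_null_comparison)
    show "\<forall>\<^sub>F \<alpha> in at_right 0. norm (norm (Kinv y - R \<alpha> y)) \<le> sqrt (B * (\<Sum>\<^sub>\<infinity>i\<in>I. t \<alpha> i * g i))"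
      using eventually_at_right_less[of "0::real"] by eventually_elim (use bound in simp)
    have "((\<lambda>\<alpha>. sqrt (B * (\<Sum>\<^sub>\<infinity>i\<in>I. t \<alpha> i * g i))) \<longlongrightarrow> sqrt (B * 0)) (at_right 0)"
      by (intro tendsto_intros dom)
    then show "((\<lambda>\<alpha>. sqrt (B * (\<Sum>\<^sub>\<infinity>i\<in>I. t \<alpha> i * g i))) \<longlongrightarrow> 0) (at_right 0)" by simp
  qed
qed

text \<open>The total error at noisy data is the error at exact data plus the image of the noise; the resulting
  bound \<open>e \<delta>\<close> is the same for all data within distance \<open>\<delta>\<close> of \<open>y\<close>, hence bounds the supremum.\<close>

lemma regularization_method_filtered_dfd:
  assumes y: "y \<in> mp_dom ipY D K"
    and a_pos: "\<And>\<delta>. 0 < \<delta> \<Longrightarrow> 0 < a \<delta>"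
    and a_0: "(a \<longlongrightarrow> 0) (at_right 0)"
    and a_noise: "((\<lambda>\<delta>. \<delta> * filter_norm (f (a \<delta>))) \<longlongrightarrow> 0) (at_right 0)"
  shows "regularization_method ipX ipY D K y R (\<lambda>\<delta> z. a \<delta>)"
  unfolding regularization_method_def
proof (intro conjI allI impI)
  show "y \<in> mp_dom ipY D K" by (rule y)
  show "continuous_on UNIV (R \<alpha>)" if "0 < \<alpha>" for \<alpha> by (rule continuous_on_filtered_dfd[OF that])
  show "0 < a \<delta>" if "0 < \<delta>" for \<delta> by (rule a_pos[OF that])
  have pos: "\<forall>\<^sub>F \<delta> in at_right 0. (0::real) < \<delta>" by (rule eventually_at_right_less)
  have ball: "y \<in> {z. norm (z - y) \<le> \<delta>}" if "0 < \<delta>" for \<delta> using that by simp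
  show "((\<lambda>\<delta>. SUP z\<in>{z. norm (z - y) \<le> \<delta>}. ereal (a \<delta>)) \<longlongrightarrow> 0) (at_right 0)"
  proof (rule Lim_transform_eventually)
    show "((\<lambda>\<delta>. ereal (a \<delta>)) \<longlongrightarrow> 0) (at_right 0)"
      using tendsto_ereal[OF a_0] by (simp add: zero_ereal_def)
    show "\<forall>\<^sub>F \<delta> in at_right 0. ereal (a \<delta>) = (SUP z\<in>{z. norm (z - y) \<le> \<delta>}. ereal (a \<delta>))"
      using pos by eventually_elim (rule SUP_const[symmetric], use ball in blast)
  qed
  obtain L where L: "0 \<le> L" "\<And>\<alpha> z. 0 < \<alpha> \<Longrightarrow> norm (R \<alpha> z) \<le> L * filter_norm (f \<alpha>) * norm z"
    using filtered_dfd_bounded by blast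
  define e where "e \<delta> = norm (Kinv y - R (a \<delta>) y) + L * (\<delta> * filter_norm (f (a \<delta>)))" for \<delta>
  have "\<forall>\<^sub>F \<delta> in at_right 0. 0 < a \<delta>" using pos by eventually_elim (rule a_pos)
  have "filterlim a (at_right 0) (at_right 0)"
    unfolding filterlim_at using a_0 \<open>\<forall>\<^sub>F \<delta> in at_right 0. 0 < a \<delta>\<close>
    by (auto elim: eventually_mono)
  then have "((\<lambda>\<delta>. norm (Kinv y - R (a \<delta>) y)) \<longlongrightarrow> 0) (at_right 0)"
    by (rule filterlim_compose[OF filtered_dfd_exact_data_tendsto[OF y]])
  then have "(e \<longlongrightarrow> 0 + L * 0) (at_right 0)"
    unfolding e_def by (intro tendsto_intros a_noise)
  then have e_lim: "((\<lambda>\<delta>. ereal (e \<delta>)) \<longlongrightarrow> 0) (at_right 0)"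
    using tendsto_ereal[of e 0] by (simp add: zero_ereal_def)
  have err: "norm (Kinv y - R (a \<delta>) z) \<le> e \<delta>" if "0 < \<delta>" "norm (z - y) \<le> \<delta>" for \<delta> z
  proof -
    have "0 \<le> filter_norm (f (a \<delta>))"
      using filt a_pos[OF that(1)]
      by (intro order_trans[OF abs_ge_zero abs_le_filter_norm[of _ 1]]) (auto simp: regularizing_filter_def)
    have "norm (Kinv y - R (a \<delta>) z) = norm ((Kinv y - R (a \<delta>) y) - R (a \<delta>) (z - y))"
      by (simp add: filtered_dfd_diff[OF a_pos[OF that(1)]])
    also have "\<dots> \<le> norm (Kinv y - R (a \<delta>) y) + norm (R (a \<delta>) (z - y))" by (rule norm_triangle_ineq4)
    also have "norm (R (a \<delta>) (z - y)) \<le> L * filter_norm (f (a \<delta>)) * norm (z - y)"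
      by (rule L(2)[OF a_pos[OF that(1)]])
    also have "\<dots> \<le> L * filter_norm (f (a \<delta>)) * \<delta>"
      using that(2) L(1) \<open>0 \<le> filter_norm (f (a \<delta>))\<close> by (intro mult_left_mono) auto
    finally show ?thesis by (simp add: e_def ac_simps)
  qed
  show "((\<lambda>\<delta>. SUP z\<in>{z. norm (z - y) \<le> \<delta>}. ereal (norm (Kinv y - R (a \<delta>) z))) \<longlongrightarrow> 0) (at_right 0)"
  proof (rule tendsto_sandwich[OF _ _ tendsto_const e_lim])
    show "\<forall>\<^sub>F \<delta> in at_right 0. 0 \<le> (SUP z\<in>{z. norm (z - y) \<le> \<delta>}. ereal (norm (Kinv y - R (a \<delta>) z)))"
      using pos by eventually_elim (rule SUP_upper2[OF ball], auto)
    show "\<forall>\<^sub>F \<delta> in at_right 0. (SUP z\<in>{z. norm (z - y) \<le> \<delta>}. ereal (norm (Kinv y - R (a \<delta>) z))) \<le> ereal (e \<delta>)"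
      using pos by eventually_elim (rule SUP_least, use err in auto)
  qed
qed

end

theorem theorem3p7:
  fixes scaleX :: "'k::scalar_field \<Rightarrow> 'x::banach \<Rightarrow> 'x"
    and ipX :: "'x \<Rightarrow> 'x \<Rightarrow> 'k"
    and scaleY :: "'k \<Rightarrow> 'y::banach \<Rightarrow> 'y"
    and ipY :: "'y \<Rightarrow> 'y \<Rightarrow> 'k"
    and D :: "'x set" and K :: "'x \<Rightarrow> 'y"
    and I :: "'i set"
    and u u' :: "'i \<Rightarrow> 'x" and v :: "'i \<Rightarrow> 'y" and \<kappa> :: "'i \<Rightarrow> real"
    and f :: "real \<Rightarrow> real \<Rightarrow> real"
    and a :: "real \<Rightarrow> real"
    and y :: 'y
  assumes "hilbert_space scaleX ipX" and "hilbert_space scaleY ipY"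
    and "closed_dense_operator scaleX scaleY D K"
    and "countable I"
    and "regularizing_filter f"
    and "dfd scaleX ipX ipY D K I u v \<kappa>"
    and "dual_frame scaleX ipX (orth_compl ipX (op_ker D K)) I u u'"
    and "y \<in> mp_dom ipY D K"
    and "\<And>\<delta>. 0 < \<delta> \<Longrightarrow> 0 < a \<delta>"
    and "(a \<longlongrightarrow> 0) (at_right 0)"
    and "((\<lambda>\<delta>. \<delta> * filter_norm (f (a \<delta>))) \<longlongrightarrow> 0) (at_right 0)"
  shows "regularization_method ipX ipY D K y
           (filtered_dfd scaleX ipY f I u' v \<kappa>) (\<lambda>\<delta> z. a \<delta>)"
proof -
  have "filtered_decomposition scaleX ipX scaleY ipY D K I u u' v \<kappa> f"
    using assms(1-3,5-7)
    by (intro filtered_decomposition.intro closed_dense_hilbert_operator.intro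
        closed_dense_hilbert_operator_axioms.intro filtered_decomposition_axioms.intro)
  from filtered_decomposition.regularization_method_filtered_dfd[OF this assms(8-11)]
  show ?thesis .
qed

end
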